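(* For every positive integer $n$, the number $\lambda(n)$ of isomorphism classes of linear $L$-algebras with exactly $n$ elements equals the Bell number $B(n-1)$, i.e. the number of partitions of a set with $n-1$ elements into non-empty subsets (with $B(0)=1$).
   Context: An $L$-algebra is a set $X$ together with a binary operation $(x,y)\mapsto x\cdot y$ such that: (i) there exists $e\in X$ with $e\cdot x=x$ and $x\cdot e=x\cdot x=e$ for all $x\in X$; (ii) $(x\cdot y)\cdot(x\cdot z)=(y\cdot x)\cdot(y\cdot z)$ for all $x,y,z\in X$; (iii) if $x\cdot y=y\cdot x=e$, then $x=y$. The natural order is the partial order $x\le y\iff x\cdot y=e$. An $L$-algebra is linear if for all $x,y\in X$, $x\le y$ or $y\le x$. An isomorphism of $L$-algebras is a bijection $f$ with $f(x\cdot y)=f(x)\cdot f(y)$ for all $x,y$. *)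

theory Defs
  imports Main "HOL-Library.Disjoint_Sets"
begin

definition logical_unit :: "'a set \<Rightarrow> ('a \<Rightarrow> 'a \<Rightarrow> 'a) \<Rightarrow> 'a \<Rightarrow> bool" where
  "logical_unit X f e \<longleftrightarrow>
     e \<in> X \<and> (\<forall>x\<in>X. f e x = x \<and> f x e = e \<and> f x x = e)"

definition L_algebra :: "'a set \<Rightarrow> ('a \<Rightarrow> 'a \<Rightarrow> 'a) \<Rightarrow> bool" where
  "L_algebra X f \<longleftrightarrow>
     (\<forall>x\<in>X. \<forall>y\<in>X. f x y \<in> X) \<and>
     (\<forall>x\<in>X. \<forall>y\<in>X. \<forall>z\<in>X. f (f x y) (f x z) = f (f y x) (f y z)) \<and>
     (\<exists>e. logical_unit X f e \<and> (\<forall>x\<in>X. \<forall>y\<in>X. f x y = e \<and> f y x = e \<longrightarrow> x = y))"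

definition L_unit :: "'a set \<Rightarrow> ('a \<Rightarrow> 'a \<Rightarrow> 'a) \<Rightarrow> 'a" where
  "L_unit X f = (THE e. logical_unit X f e)"

definition L_le :: "'a set \<Rightarrow> ('a \<Rightarrow> 'a \<Rightarrow> 'a) \<Rightarrow> 'a \<Rightarrow> 'a \<Rightarrow> bool" where
  "L_le X f x y \<longleftrightarrow> f x y = L_unit X f"

definition linear_L_algebra :: "'a set \<Rightarrow> ('a \<Rightarrow> 'a \<Rightarrow> 'a) \<Rightarrow> bool" where
  "linear_L_algebra X f \<longleftrightarrow>
     L_algebra X f \<and> (\<forall>x\<in>X. \<forall>y\<in>X. L_le X f x y \<or> L_le X f y x)"

definition L_isomorphic ::
    "'a set \<times> ('a \<Rightarrow> 'a \<Rightarrow> 'a) \<Rightarrow> 'b set \<times> ('b \<Rightarrow> 'b \<Rightarrow> 'b) \<Rightarrow> bool" where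
  "L_isomorphic = (\<lambda>(X, f) (Y, g).
     \<exists>h. bij_betw h X Y \<and> (\<forall>x\<in>X. \<forall>y\<in>X. h (f x y) = g (h x) (h y)))"

text \<open>
  The carriers range over all \<open>n\<close>-element sets of natural numbers. This loses nothing: by
  \<open>linear_L_algebra_nat_copy\<close> below, every finite linear \<open>L\<close>-algebra, over any type, is isomorphic
  to one of these. The values of an operation outside its carrier are irrelevant, since operations
  that agree on the carrier give isomorphic structures and hence the same class.
\<close>

definition linear_L_algebras :: "nat \<Rightarrow> (nat set \<times> (nat \<Rightarrow> nat \<Rightarrow> nat)) set" where
  "linear_L_algebras n = {(X, f). finite X \<and> card X = n \<and> linear_L_algebra X f}"

definition L_iso_rel ::
    "nat \<Rightarrow> ((nat set \<times> (nat \<Rightarrow> nat \<Rightarrow> nat)) \<times> (nat set \<times> (nat \<Rightarrow> nat \<Rightarrow> nat))) set" where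
  "L_iso_rel n =
     {(A, B). A \<in> linear_L_algebras n \<and> B \<in> linear_L_algebras n \<and> L_isomorphic A B}"

definition num_linear_L_algebras :: "nat \<Rightarrow> nat" where
  "num_linear_L_algebras n = card (linear_L_algebras n // L_iso_rel n)"

definition Bell :: "nat \<Rightarrow> nat" where
  "Bell n = card {P. partition_on {..<n} P}"

lemma Bell_0: "Bell 0 = 1"
proof -
  have "{P :: nat set set. partition_on {..<0} P} = {{}}"
    by (auto simp: partition_on_def)
  then show ?thesis by (simp add: Bell_def)
qed

lemma logical_unit_unique:
  assumes "logical_unit X f e" "logical_unit X f e'"
  shows "e = e'"
  using assms unfolding logical_unit_def by metis

lemma L_unit_eq:
  assumes "logical_unit X f e"
  shows "L_unit X f = e"
  unfolding L_unit_def using assms logical_unit_unique by (metis the_equality)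

lemma L_isomorphic_refl: "L_isomorphic A A"
  unfolding L_isomorphic_def by (auto intro!: exI[of _ id] split: prod.split)

lemma L_isomorphic_trans:
  assumes "L_isomorphic A B" "L_isomorphic B C"
  shows "L_isomorphic A C"
proof -
  obtain X f Y g Z k where eq: "A = (X, f)" "B = (Y, g)" "C = (Z, k)"
    by (metis surj_pair)
  obtain h1 h2 where
    h1: "bij_betw h1 X Y" "\<forall>x\<in>X. \<forall>y\<in>X. h1 (f x y) = g (h1 x) (h1 y)" and
    h2: "bij_betw h2 Y Z" "\<forall>x\<in>Y. \<forall>y\<in>Y. h2 (g x y) = k (h2 x) (h2 y)"
    using assms unfolding eq L_isomorphic_def by auto
  have "bij_betw (h2 \<circ> h1) X Z" using h1(1) h2(1) by (rule bij_betw_trans)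
  moreover have "\<forall>x\<in>X. \<forall>y\<in>X. (h2 \<circ> h1) (f x y) = k ((h2 \<circ> h1) x) ((h2 \<circ> h1) y)"
    using h1 h2(2) by (auto simp: bij_betw_def)
  ultimately show ?thesis unfolding eq L_isomorphic_def by blast
qed

lemma L_isomorphic_sym:
  assumes "L_isomorphic (X, f) (Y, g)" and closed: "\<forall>x\<in>X. \<forall>y\<in>X. f x y \<in> X"
  shows "L_isomorphic (Y, g) (X, f)"
proof -
  obtain h where h: "bij_betw h X Y" "\<forall>x\<in>X. \<forall>y\<in>X. h (f x y) = g (h x) (h y)"
    using assms unfolding L_isomorphic_def by auto
  define i where "i = inv_into X h"
  have i: "bij_betw i Y X" unfolding i_def using h(1) by (rule bij_betw_inv_into)
  have "i (g x y) = f (i x) (i y)" if "x \<in> Y" "y \<in> Y" for x y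
  proof -
    have m: "i x \<in> X" "i y \<in> X" using i that by (auto simp: bij_betw_def)
    have "h (i x) = x" "h (i y) = y"
      using that h(1) unfolding i_def by (auto simp: bij_betw_inv_into_right)
    then have "g x y = h (f (i x) (i y))" using h(2) m by simp
    then show ?thesis
      using closed m h(1) unfolding i_def by (simp add: bij_betw_inv_into_left)
  qed
  with i show ?thesis unfolding L_isomorphic_def by auto
qed

lemma equiv_L_iso_rel: "equiv (linear_L_algebras n) (L_iso_rel n)"
proof (rule equivI)
  show "L_iso_rel n \<subseteq> linear_L_algebras n \<times> linear_L_algebras n"
    by (auto simp: L_iso_rel_def)
  show "refl_on (linear_L_algebras n) (L_iso_rel n)"
    by (auto simp: refl_on_def L_iso_rel_def L_isomorphic_refl)
  show "sym (L_iso_rel n)"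
    by (auto simp: sym_def L_iso_rel_def linear_L_algebras_def linear_L_algebra_def L_algebra_def
        intro!: L_isomorphic_sym)
  show "trans (L_iso_rel n)"
    by (auto simp: trans_def L_iso_rel_def intro: L_isomorphic_trans)
qed

lemma linear_L_algebra_nat_copy:
  fixes X :: "'a set"
  assumes lin: "linear_L_algebra X f" and fin: "finite X"
  shows "\<exists>A \<in> linear_L_algebras (card X). L_isomorphic (X, f) A"
proof -
  define Y where "Y = {0..<card X}"
  obtain h :: "'a \<Rightarrow> nat" where h: "bij_betw h X Y"
    using ex_bij_betw_finite_nat[OF fin] Y_def by blast
  define i where "i = inv_into X h"
  define g where "g u v = h (f (i u) (i v))" for u v
  have hX: "h ` X = Y" using h by (auto simp: bij_betw_def)
  have ih: "\<And>x. x \<in> X \<Longrightarrow> i (h x) = x"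
    unfolding i_def using h by (simp add: bij_betw_inv_into_left)
  have inj: "\<And>x y. x \<in> X \<Longrightarrow> y \<in> X \<Longrightarrow> h x = h y \<longleftrightarrow> x = y"
    using h by (auto simp: bij_betw_def inj_on_def)
  have gh: "\<And>x y. x \<in> X \<Longrightarrow> y \<in> X \<Longrightarrow> g (h x) (h y) = h (f x y)"
    by (simp add: g_def ih)
  have closed: "\<And>x y. x \<in> X \<Longrightarrow> y \<in> X \<Longrightarrow> f x y \<in> X"
    and cycloid: "\<And>x y z. x \<in> X \<Longrightarrow> y \<in> X \<Longrightarrow> z \<in> X \<Longrightarrow> f (f x y) (f x z) = f (f y x) (f y z)"
    using lin by (auto simp: linear_L_algebra_def L_algebra_def)
  obtain e where e: "logical_unit X f e"
    and anti: "\<And>x y. x \<in> X \<Longrightarrow> y \<in> X \<Longrightarrow> f x y = e \<Longrightarrow> f y x = e \<Longrightarrow> x = y"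
    using lin unfolding linear_L_algebra_def L_algebra_def by blast
  have eX: "e \<in> X" using e by (simp add: logical_unit_def)
  have tot: "\<And>x y. x \<in> X \<Longrightarrow> y \<in> X \<Longrightarrow> f x y = e \<or> f y x = e"
    using lin L_unit_eq[OF e] by (auto simp: linear_L_algebra_def L_le_def)
  have u: "logical_unit Y g (h e)"
    using e eX unfolding logical_unit_def hX[symmetric] by (simp add: gh)
  have "L_algebra Y g"
    unfolding L_algebra_def
  proof (intro conjI exI[of _ "h e"])
    show "\<forall>x\<in>Y. \<forall>y\<in>Y. g x y \<in> Y"
      unfolding hX[symmetric] by (auto simp: gh closed)
    show "\<forall>x\<in>Y. \<forall>y\<in>Y. \<forall>z\<in>Y. g (g x y) (g x z) = g (g y x) (g y z)"
      unfolding hX[symmetric] by (simp add: gh closed cycloid)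
    show "\<forall>x\<in>Y. \<forall>y\<in>Y. g x y = h e \<and> g y x = h e \<longrightarrow> x = y"
      unfolding hX[symmetric] by (auto simp: gh closed inj eX anti)
  qed (rule u)
  moreover have "\<forall>x\<in>Y. \<forall>y\<in>Y. L_le Y g x y \<or> L_le Y g y x"
    unfolding L_le_def L_unit_eq[OF u] unfolding hX[symmetric] using tot by (auto simp: gh closed inj eX)
  ultimately have "(Y, g) \<in> linear_L_algebras (card X)"
    by (simp add: linear_L_algebras_def linear_L_algebra_def Y_def)
  moreover have "L_isomorphic (X, f) (Y, g)"
    using h gh unfolding L_isomorphic_def by auto
  ultimately show ?thesis by blast
qed

end

theory Submission
  imports Defs "HOL.Binomial"
begin

text \<open>
  Number the elements of a linear \<open>L\<close>-algebra with operation \<open>f\<close> from the top as \<open>0, \<dots>, m\<close>. Then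
  \<open>f i k = 0\<close> means \<open>k \<le> i\<close>, and the defining equation becomes \<open>f (f i j) (f i k) = f j k\<close> for
  \<open>i \<le> j\<close>; it makes each row \<open>k \<mapsto> f i k\<close> strictly increasing on \<open>{i..m}\<close>. Finite chains are
  rigid, so every isomorphism class contains exactly one such operation.

  Let \<open>g\<close> be the first row that moves the bottom element \<open>m\<close>. Applying the equation to a row
  \<open>i < g\<close>, to \<open>g\<close> and to the bottom element shows that \<open>f i\<close> fixes \<open>g\<close>, hence everything from \<open>g\<close>
  on. The later rows are determined by row \<open>g\<close>, because \<open>f j k = f (f g j) (f g k)\<close> with
  \<open>f g j < j\<close>. Conversely, any operation on \<open>{..<g}\<close> and any strictly increasing row
  \<open>{g<..m} \<rightarrow> {1..<m}\<close> can be combined in this way. For \<open>m \<ge> 1\<close> therefore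
  \<open>\<lambda>(m + 1) = (\<Sum>g=1..m. (m - 1 choose g - 1) * \<lambda>(g))\<close>, the recurrence of the Bell numbers.
\<close>

section \<open>Finite linear orders and strictly increasing maps\<close>

lemma linear_order_on_Field: "linear_order_on A r \<Longrightarrow> Field r = A"
  by (auto simp: order_on_defs refl_on_def Field_def)

lemma card_underS_le_iff:
  assumes "finite A" and r: "linear_order_on A r" and "x \<in> A" "y \<in> A"
  shows "card (underS r x) \<le> card (underS r y) \<longleftrightarrow> (x, y) \<in> r"
proof -
  note Field = linear_order_on_Field[OF r]
  have fin: "finite (underS r z)" for z
    using \<open>finite A\<close> Order_Relation.underS_Field[of r z] by (auto simp: Field intro: finite_subset)
  have subset_iff: "underS r z \<subseteq> underS r w \<longleftrightarrow> (z, w) \<in> r" if "z \<in> A" "w \<in> A" for z w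
    using that r by (intro underS_incl_iff) (simp_all add: Field)
  have "underS r x \<subseteq> underS r y \<or> underS r y \<subseteq> underS r x"
    using assms by (cases "x = y") (auto simp: subset_iff order_on_defs total_on_def)
  then have "card (underS r x) \<le> card (underS r y) \<longleftrightarrow> underS r x \<subseteq> underS r y"
    by (metis card_mono card_seteq fin order_refl)
  then show ?thesis using assms by (simp add: subset_iff)
qed

lemma finite_linear_order_rank:
  assumes "finite A" and r: "linear_order_on A r"
  obtains t where "bij_betw t A {..<card A}"
    and "\<And>x y. x \<in> A \<Longrightarrow> y \<in> A \<Longrightarrow> (x, y) \<in> r \<longleftrightarrow> t x \<le> t y"
proof
  let ?t = "\<lambda>x. card (underS r x)"
  show le_iff: "(x, y) \<in> r \<longleftrightarrow> ?t x \<le> ?t y" if "x \<in> A" "y \<in> A" for x y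
    using card_underS_le_iff[OF assms that] by simp
  have inj: "inj_on ?t A"
  proof (rule inj_onI)
    fix x y assume "x \<in> A" "y \<in> A" "?t x = ?t y"
    then have "(x, y) \<in> r" "(y, x) \<in> r" by (simp_all add: le_iff)
    then show "x = y" using r by (auto simp: order_on_defs dest: antisymD)
  qed
  have "?t x < card A" if "x \<in> A" for x
    using that \<open>finite A\<close> underS_Field2[of x r]
    by (intro psubset_card_mono) (simp_all add: linear_order_on_Field[OF r])
  then have "?t ` A = {..<card A}"
    using inj by (intro card_subset_eq) (auto simp: card_image)
  with inj show "bij_betw ?t A {..<card A}" by (simp add: bij_betw_def)
qed

lemma ex_bij_betw_strict_mono:
  fixes A :: "'a::linorder set" and B :: "'b::linorder set"
  assumes "finite A" "finite B" "card A = card B"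
  obtains f where "strict_mono_on A f" "bij_betw f A B"
proof -
  have "linear_order_on C (relation_of (\<le>) C)" for C :: "'c::linorder set"
    by (auto simp: order_on_defs relation_of_def refl_on_def trans_def antisym_def total_on_def)
  note rank = finite_linear_order_rank[OF _ this]
  obtain s where s: "bij_betw s A {..<card A}"
    and s_le: "\<And>x y. x \<in> A \<Longrightarrow> y \<in> A \<Longrightarrow> x \<le> y \<longleftrightarrow> s x \<le> s y"
    using rank[OF \<open>finite A\<close>] unfolding relation_of_def by auto
  obtain t where t: "bij_betw t B {..<card A}"
    and t_le: "\<And>x y. x \<in> B \<Longrightarrow> y \<in> B \<Longrightarrow> x \<le> y \<longleftrightarrow> t x \<le> t y"
    using rank[OF \<open>finite B\<close>] \<open>card A = card B\<close> unfolding relation_of_def by auto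
  define f where "f = inv_into B t \<circ> s"
  have f: "bij_betw f A B"
    unfolding f_def using s bij_betw_inv_into[OF t] by (rule bij_betw_trans)
  have "t (f x) = s x" if "x \<in> A" for x
    using that bij_betwE[OF s] bij_betw_inv_into_right[OF t] by (simp add: f_def)
  then have "strict_mono_on A f"
    using s_le t_le bij_betwE[OF f] by (intro strict_mono_onI) (metis not_le)
  with f show thesis using that by blast
qed

lemma strict_mono_on_eq_if_image_eq:
  fixes f g :: "'a::linorder \<Rightarrow> 'b::linorder"
  assumes "finite A" "strict_mono_on A f" "strict_mono_on A g" "f ` A = g ` A" "x \<in> A"
  shows "f x = g x"
proof -
  let ?xs = "sorted_list_of_set A"
  have "sorted_wrt (<) (map h ?xs)" if "strict_mono_on A h" for h :: "'a \<Rightarrow> 'b"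
    using that \<open>finite A\<close> unfolding sorted_wrt_map
    by (intro sorted_wrt_mono_rel[OF _ strict_sorted_list_of_set]) (auto dest: strict_mono_onD)
  then have "map f ?xs = map g ?xs"
    using assms by (intro strict_sorted_equal) auto
  then show ?thesis using assms by simp
qed

lemma strict_mono_on_diff_le:
  fixes f :: "nat \<Rightarrow> nat"
  assumes "strict_mono_on {k..l} f" "k \<le> l"
  shows "f k + (l - k) \<le> f l"
  using assms(2,1)
proof (induction l rule: dec_induct)
  case (step l)
  have "strict_mono_on {k..l} f" by (rule monotone_on_subset[OF step.prems]) auto
  then have "f k + (l - k) \<le> f l" by (rule step.IH)
  also have "f l < f (Suc l)" using step by (intro strict_mono_onD[OF step.prems]) auto
  finally show ?case using step.hyps by simp
qed simp

definition strict_mono_maps :: "'a::linorder set \<Rightarrow> 'b::{linorder, zero} set \<Rightarrow> ('a \<Rightarrow> 'b) set" where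
  "strict_mono_maps A B = {f. strict_mono_on A f \<and> f ` A \<subseteq> B \<and> (\<forall>x. x \<notin> A \<longrightarrow> f x = 0)}"

lemma bij_betw_strict_mono_maps_image:
  assumes "finite A" "finite B"
  shows "bij_betw (\<lambda>f. f ` A) (strict_mono_maps A B) {S. S \<subseteq> B \<and> card S = card A}"
proof (rule bij_betw_imageI)
  show "inj_on (\<lambda>f. f ` A) (strict_mono_maps A B)"
  proof (intro inj_onI ext)
    fix f g x assume "f \<in> strict_mono_maps A B" "g \<in> strict_mono_maps A B" "f ` A = g ` A"
    then show "f x = g x"
      using strict_mono_on_eq_if_image_eq[OF \<open>finite A\<close>, of f g x]
      by (cases "x \<in> A") (auto simp: strict_mono_maps_def)
  qed
  show "(\<lambda>f. f ` A) ` strict_mono_maps A B = {S. S \<subseteq> B \<and> card S = card A}"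
  proof (intro equalityI subsetI)
    fix S assume "S \<in> (\<lambda>f. f ` A) ` strict_mono_maps A B"
    then show "S \<in> {S. S \<subseteq> B \<and> card S = card A}"
      by (auto simp: strict_mono_maps_def card_image strict_mono_on_imp_inj_on)
  next
    fix S assume S: "S \<in> {S. S \<subseteq> B \<and> card S = card A}"
    then obtain f where f: "strict_mono_on A f" "bij_betw f A S"
      using assms ex_bij_betw_strict_mono[of A S] by (auto intro: finite_subset)
    define f' where "f' x = (if x \<in> A then f x else 0)" for x
    have "f' \<in> strict_mono_maps A B" "f' ` A = S"
      using f S by (auto simp: strict_mono_maps_def f'_def bij_betw_def monotone_on_def)
    then show "S \<in> (\<lambda>f. f ` A) ` strict_mono_maps A B" by blast
  qed
qed

lemma finite_strict_mono_maps: "finite A \<Longrightarrow> finite B \<Longrightarrow> finite (strict_mono_maps A B)"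
  by (simp add: bij_betw_finite[OF bij_betw_strict_mono_maps_image])

lemma card_strict_mono_maps:
  "finite A \<Longrightarrow> finite B \<Longrightarrow> card (strict_mono_maps A B) = card B choose card A"
  by (simp add: bij_betw_same_card[OF bij_betw_strict_mono_maps_image] n_subsets)

section \<open>Bell numbers\<close>

lemma card_partitions_le_if_bij_betw:
  assumes h: "bij_betw h A B" and "finite B"
  shows "card {P. partition_on A P} \<le> card {P. partition_on B P}"
proof (rule card_inj_on_le)
  have "inj_on ((`) ((`) h)) (Pow (Pow A))"
    using h by (auto intro!: inj_on_image_Pow simp: bij_betw_def)
  then show "inj_on ((`) ((`) h)) {P. partition_on A P}"
    by (rule inj_on_subset) (auto dest: partition_onD1)
  show "(`) ((`) h) ` {P. partition_on A P} \<subseteq> {P. partition_on B P}"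
  proof clarify
    fix P assume P: "partition_on A P"
    then have "(`) h ` P - {{}} = (`) h ` P" by (auto dest: partition_onD3)
    then show "partition_on B ((`) h ` P)"
      using partition_on_inj_image[OF P, of h] h by (simp add: bij_betw_def)
  qed
qed (use \<open>finite B\<close> in \<open>rule finitely_many_partition_on\<close>)

lemma card_partitions_eq_Bell:
  assumes "finite A"
  shows "card {P. partition_on A P} = Bell (card A)"
proof -
  obtain h where "bij_betw h A {..<card A}"
    using ex_bij_betw_finite_nat[OF assms] by (auto simp: atLeast0LessThan)
  then show ?thesis
    unfolding Bell_def using assms
    by (intro antisym card_partitions_le_if_bij_betw[of h]
        card_partitions_le_if_bij_betw[of "inv_into A h"])
      (auto intro: bij_betw_inv_into)
qed

lemma partition_on_insert_complement:
  assumes "a \<notin> A" "R \<subseteq> A" "partition_on R Q"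
  shows "partition_on (insert a A) (insert (insert a A - R) Q)"
proof -
  have "disjnt (insert a A - R) (\<Union>Q)"
    using partition_onD1[OF assms(3)] by (auto simp: disjnt_def)
  moreover have "insert a A - (insert a A - R) = R" "a \<notin> R" using assms by auto
  ultimately show ?thesis using assms(3) by (auto simp: partition_on_insert)
qed

lemma partition_on_insertE:
  assumes P: "partition_on (insert a A) P"
  obtains R Q where "R \<subseteq> A" "partition_on R Q" "P = insert (insert a A - R) Q"
proof -
  obtain B where B: "B \<in> P" "a \<in> B" "B \<subseteq> insert a A"
    using partition_onD1[OF P] by blast
  have "disjnt B (\<Union>(P - {B}))"
    using P \<open>B \<in> P\<close> by (auto simp: partition_on_def disjnt_def pairwise_def)
  then have rest: "partition_on (insert a A - B) (P - {B})"
    using P \<open>B \<in> P\<close> partition_on_insert[of B "P - {B}"] by (simp add: insert_absorb)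
  have join: "P = insert (insert a A - (insert a A - B)) (P - {B})"
    unfolding double_diff[OF B(3) order_refl] using \<open>B \<in> P\<close> by (simp add: insert_absorb)
  show thesis using \<open>a \<in> B\<close> by (intro that[OF _ rest join]) auto
qed

lemma bij_betw_partitions_insert:
  assumes "a \<notin> A"
  shows "bij_betw (\<lambda>(R, Q). insert (insert a A - R) Q)
    (SIGMA R:Pow A. {Q. partition_on R Q}) {P. partition_on (insert a A) P}"
proof (rule bij_betw_imageI)
  have rest: "{p \<in> insert (insert a A - R) Q. a \<notin> p} = Q" "\<Union>Q = R"
    if "R \<subseteq> A" "partition_on R Q" for R Q
    using that \<open>a \<notin> A\<close> by (auto simp: partition_on_def)
  show "inj_on (\<lambda>(R, Q). insert (insert a A - R) Q) (SIGMA R:Pow A. {Q. partition_on R Q})"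
  proof (rule inj_onI, clarify)
    fix R Q R' Q'
    assume P: "R \<subseteq> A" "partition_on R Q" and P': "R' \<subseteq> A" "partition_on R' Q'"
      and "insert (insert a A - R) Q = insert (insert a A - R') Q'"
    then have "Q = Q'" using rest(1)[OF P] rest(1)[OF P'] by simp
    then show "R = R' \<and> Q = Q'" using rest(2)[OF P] rest(2)[OF P'] by simp
  qed
  show "(\<lambda>(R, Q). insert (insert a A - R) Q) ` (SIGMA R:Pow A. {Q. partition_on R Q})
      = {P. partition_on (insert a A) P}"
  proof (intro equalityI subsetI)
    fix P assume "P \<in> {P. partition_on (insert a A) P}"
    then obtain R Q where "R \<subseteq> A" "partition_on R Q" "P = insert (insert a A - R) Q"
      by (auto elim: partition_on_insertE)
    then show "P \<in> (\<lambda>(R, Q). insert (insert a A - R) Q) ` (SIGMA R:Pow A. {Q. partition_on R Q})"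
      by (intro image_eqI[of _ _ "(R, Q)"]) simp_all
  qed (use partition_on_insert_complement[OF assms] in auto)
qed

lemma sum_Pow_card:
  fixes F :: "nat \<Rightarrow> 'a::semiring_1"
  assumes "finite S"
  shows "(\<Sum>A\<in>Pow S. F (card A)) = (\<Sum>k\<le>card S. of_nat (card S choose k) * F k)"
proof -
  have "(\<Sum>A\<in>Pow S. F (card A)) = (\<Sum>k\<le>card S. \<Sum>A\<in>{A \<in> Pow S. card A = k}. F (card A))"
    by (rule sum.group[symmetric]) (use assms in \<open>auto intro: card_mono\<close>)
  also have "\<dots> = (\<Sum>k\<le>card S. of_nat (card {A. A \<subseteq> S \<and> card A = k}) * F k)"
    by (rule sum.cong) auto
  finally show ?thesis using assms by (simp add: n_subsets)
qed

lemma Bell_Suc: "Bell (Suc n) = (\<Sum>k\<le>n. (n choose k) * Bell k)"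
proof -
  have "Bell (Suc n) = card (SIGMA R:Pow {..<n}. {Q. partition_on R Q})"
    using bij_betw_same_card[OF bij_betw_partitions_insert[of n "{..<n}"]]
    by (simp add: Bell_def lessThan_Suc)
  also have "\<dots> = (\<Sum>R\<in>Pow {..<n}. card {Q. partition_on R Q})"
    by (rule card_SigmaI) (auto intro: finitely_many_partition_on finite_subset)
  also have "\<dots> = (\<Sum>R\<in>Pow {..<n}. Bell (card R))"
    by (rule sum.cong) (auto intro: card_partitions_eq_Bell finite_subset)
  also have "\<dots> = (\<Sum>k\<le>n. (n choose k) * Bell k)"
    using sum_Pow_card[of "{..<n}" Bell] by simp
  finally show ?thesis .
qed

section \<open>Linear L-algebras\<close>

lemma
  assumes "L_algebra X f"
  shows L_algebra_closed: "x \<in> X \<Longrightarrow> y \<in> X \<Longrightarrow> f x y \<in> X"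
    and L_algebra_cycloid:
      "x \<in> X \<Longrightarrow> y \<in> X \<Longrightarrow> z \<in> X \<Longrightarrow> f (f x y) (f x z) = f (f y x) (f y z)"
    and logical_unit_L_unit: "logical_unit X f (L_unit X f)"
    and L_le_antisym: "x \<in> X \<Longrightarrow> y \<in> X \<Longrightarrow> L_le X f x y \<Longrightarrow> L_le X f y x \<Longrightarrow> x = y"
proof -
  obtain e where e: "logical_unit X f e"
    and e_antisym: "\<forall>x\<in>X. \<forall>y\<in>X. f x y = e \<and> f y x = e \<longrightarrow> x = y"
    using assms by (auto simp: L_algebra_def)
  from e show "logical_unit X f (L_unit X f)" by (simp add: L_unit_eq)
  show "x \<in> X \<Longrightarrow> y \<in> X \<Longrightarrow> L_le X f x y \<Longrightarrow> L_le X f y x \<Longrightarrow> x = y"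
    using e_antisym by (simp add: L_le_def L_unit_eq[OF e])
qed (use assms in \<open>simp_all add: L_algebra_def\<close>)

lemma
  assumes "L_algebra X f"
  shows L_unit_in: "L_unit X f \<in> X"
    and L_unit_left: "x \<in> X \<Longrightarrow> f (L_unit X f) x = x"
    and L_unit_right: "x \<in> X \<Longrightarrow> f x (L_unit X f) = L_unit X f"
    and L_algebra_self: "x \<in> X \<Longrightarrow> f x x = L_unit X f"
  using logical_unit_L_unit[OF assms] by (auto simp: logical_unit_def)

lemma L_le_cycloid:
  assumes L: "L_algebra X f" and X: "x \<in> X" "y \<in> X" "z \<in> X" and below: "L_le X f x y"
  shows "f (f y x) (f y z) = f x z"
proof -
  have "f (f y x) (f y z) = f (f x y) (f x z)"
    using L_algebra_cycloid[OF L] X by metis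
  also have "\<dots> = f x z"
    using below X L_unit_left[OF L] L_algebra_closed[OF L] by (simp add: L_le_def)
  finally show ?thesis .
qed

lemma L_le_trans:
  assumes L: "L_algebra X f" and X: "x \<in> X" "y \<in> X" "z \<in> X"
    and below: "L_le X f x y" "L_le X f y z"
  shows "L_le X f x z"
proof -
  have "f x z = f (f y x) (f y z)" using L_le_cycloid[OF L X below(1)] by simp
  also have "\<dots> = L_unit X f"
    using below(2) X L_unit_right[OF L] L_algebra_closed[OF L] by (simp add: L_le_def)
  finally show ?thesis by (simp add: L_le_def)
qed

lemma linear_order_on_L_le:
  assumes "linear_L_algebra X f"
  shows "linear_order_on X (relation_of (L_le X f) X)"
proof -
  have L: "L_algebra X f" and total: "\<And>x y. x \<in> X \<Longrightarrow> y \<in> X \<Longrightarrow> L_le X f x y \<or> L_le X f y x"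
    using assms by (auto simp: linear_L_algebra_def)
  show ?thesis
    unfolding order_on_defs refl_on_def trans_def antisym_def total_on_def relation_of_def
    using total L_le_antisym[OF L] L_le_trans[OF L] by blast
qed

lemma
  assumes L: "L_algebra X f" and h: "bij_betw h X Y"
    and hom: "\<And>x y. x \<in> X \<Longrightarrow> y \<in> X \<Longrightarrow> h (f x y) = g (h x) (h y)"
  shows L_algebra_isomorphic: "L_algebra Y g"
    and L_unit_isomorphic: "L_unit Y g = h (L_unit X f)"
proof -
  have Y: "Y = h ` X" and inj: "inj_on h X" using h by (auto simp: bij_betw_def)
  note closed = L_algebra_closed[OF L]
  have unit: "logical_unit Y g (h (L_unit X f))"
    unfolding logical_unit_def Y
    using L_unit_in[OF L] L_unit_left[OF L] L_unit_right[OF L] L_algebra_self[OF L]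
    by (auto simp flip: hom)
  then show "L_unit Y g = h (L_unit X f)" by (rule L_unit_eq)
  show "L_algebra Y g"
    unfolding L_algebra_def
  proof (intro conjI exI)
    show "\<forall>x\<in>Y. \<forall>y\<in>Y. g x y \<in> Y"
      using closed by (auto simp: Y simp flip: hom)
    show "\<forall>x\<in>Y. \<forall>y\<in>Y. \<forall>z\<in>Y. g (g x y) (g x z) = g (g y x) (g y z)"
      using closed L_algebra_cycloid[OF L] by (auto simp: Y simp flip: hom)
    show "\<forall>x\<in>Y. \<forall>y\<in>Y. g x y = h (L_unit X f) \<and> g y x = h (L_unit X f) \<longrightarrow> x = y"
      using closed L_unit_in[OF L] L_le_antisym[OF L] inj
      by (auto simp: Y L_le_def inj_on_eq_iff simp flip: hom)
  qed (rule unit)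
qed

section \<open>Chains of natural numbers\<close>

text \<open>
  The elements are numbered from the top: \<open>0\<close> is the unit, and the natural order is the reverse of
  the order of the numbers. The value \<open>0\<close> outside the carrier makes each operation determined by its
  restriction to the carrier.
\<close>

definition L_chain :: "nat \<Rightarrow> (nat \<Rightarrow> nat \<Rightarrow> nat) \<Rightarrow> bool" where
  "L_chain n f \<longleftrightarrow> L_algebra {..<n} f \<and> (\<forall>i<n. \<forall>k<n. f i k = 0 \<longleftrightarrow> k \<le> i) \<and>
     (\<forall>i k. n \<le> i \<or> n \<le> k \<longrightarrow> f i k = 0)"

lemma
  assumes f: "L_chain n f"
  shows L_chain_L_algebra: "L_algebra {..<n} f"
    and L_chain_eq_0_iff: "i < n \<Longrightarrow> k < n \<Longrightarrow> f i k = 0 \<longleftrightarrow> k \<le> i"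
    and L_chain_outside: "n \<le> i \<or> n \<le> k \<Longrightarrow> f i k = 0"
    and L_chain_pos: "0 < n"
    and L_chain_unit: "L_unit {..<n} f = 0"
proof -
  show L: "L_algebra {..<n} f" and zero: "i < n \<Longrightarrow> k < n \<Longrightarrow> f i k = 0 \<longleftrightarrow> k \<le> i"
    and "n \<le> i \<or> n \<le> k \<Longrightarrow> f i k = 0" for i k
    using f by (auto simp: L_chain_def)
  show "0 < n" using L_unit_in[OF L] by simp
  then show "L_unit {..<n} f = 0" using L_algebra_self[OF L, of 0] zero[of 0 0] by simp
qed

lemma
  assumes f: "L_chain n f"
  shows L_chain_less: "f i k < n"
    and L_chain_0: "k < n \<Longrightarrow> f 0 k = k"
    and L_chain_L_le_iff: "i < n \<Longrightarrow> k < n \<Longrightarrow> L_le {..<n} f i k \<longleftrightarrow> k \<le> i"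
    and L_chain_cycloid: "i \<le> j \<Longrightarrow> j < n \<Longrightarrow> k < n \<Longrightarrow> f (f i j) (f i k) = f j k"
proof -
  note L = L_chain_L_algebra[OF f]
  show "f i k < n" for i k
    using L_algebra_closed[OF L, of i k] L_chain_outside[OF f, of i k] L_chain_pos[OF f]
    by (cases "i < n \<and> k < n") auto
  show "k < n \<Longrightarrow> f 0 k = k" for k
    using L_unit_left[OF L, of k] by (simp add: L_chain_unit[OF f])
  show L_le_iff: "i < n \<Longrightarrow> k < n \<Longrightarrow> L_le {..<n} f i k \<longleftrightarrow> k \<le> i" for i k
    using f by (simp add: L_le_def L_chain_unit L_chain_eq_0_iff)
  show "i \<le> j \<Longrightarrow> j < n \<Longrightarrow> k < n \<Longrightarrow> f (f i j) (f i k) = f j k" for i j k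
    using L_le_cycloid[OF L, of j i k] L_le_iff[of j i] by simp
qed

lemma L_chainI:
  assumes "0 < n"
    and closed: "\<And>i k. i < n \<Longrightarrow> k < n \<Longrightarrow> f i k < n"
    and zero: "\<And>i k. i < n \<Longrightarrow> k < n \<Longrightarrow> f i k = 0 \<longleftrightarrow> k \<le> i"
    and left: "\<And>k. k < n \<Longrightarrow> f 0 k = k"
    and cycloid: "\<And>i j k. i \<le> j \<Longrightarrow> j < n \<Longrightarrow> k < n \<Longrightarrow> f (f i j) (f i k) = f j k"
    and outside: "\<And>i k. n \<le> i \<or> n \<le> k \<Longrightarrow> f i k = 0"
  shows "L_chain n f"
proof -
  have unit: "logical_unit {..<n} f 0"
    using \<open>0 < n\<close> zero left by (auto simp: logical_unit_def)
  have "f (f x y) (f x z) = f (f y x) (f y z)" if "x \<le> y" "y < n" "z < n" for x y z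
  proof -
    have "f y x = 0" using that zero[of y x] by simp
    then have "f (f y x) (f y z) = f y z" using that closed left by simp
    then show ?thesis using that cycloid by simp
  qed
  then have "\<forall>x\<in>{..<n}. \<forall>y\<in>{..<n}. \<forall>z\<in>{..<n}. f (f x y) (f x z) = f (f y x) (f y z)"
    by (metis lessThan_iff nle_le)
  then have "L_algebra {..<n} f"
    unfolding L_algebra_def using unit closed zero by (auto intro!: exI[of _ 0])
  then show ?thesis using zero outside by (simp add: L_chain_def)
qed

lemma L_chain_strict_mono_on:
  assumes f: "L_chain n f" and "i < n"
  shows "strict_mono_on {i..<n} (f i)"
proof (rule strict_mono_onI)
  fix k l assume kl: "k \<in> {i..<n}" "l \<in> {i..<n}" "k < l"
  then have "f (f i k) (f i l) \<noteq> 0"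
    using L_chain_cycloid[OF f, of i k l] L_chain_eq_0_iff[OF f, of k l] by simp
  then show "f i k < f i l" using L_chain_less[OF f] by (simp add: L_chain_eq_0_iff[OF f])
qed

lemma L_chain_le:
  assumes f: "L_chain n f"
  shows "f i k \<le> k"
proof (cases "i \<le> k \<and> k < n")
  case True
  then have "f i k + (n - 1 - k) \<le> f i (n - 1)"
    by (intro strict_mono_on_diff_le monotone_on_subset[OF L_chain_strict_mono_on[OF f]]) auto
  then show ?thesis using True L_chain_less[OF f, of i "n - 1"] by linarith
next
  case False
  then show ?thesis
    using L_chain_outside[OF f, of i k] L_chain_eq_0_iff[OF f, of i k] by (cases "i < n \<and> k < n") auto
qed

definition restrict_op :: "nat \<Rightarrow> (nat \<Rightarrow> nat \<Rightarrow> nat) \<Rightarrow> nat \<Rightarrow> nat \<Rightarrow> nat" where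
  "restrict_op n f i k = (if i < n \<and> k < n then f i k else 0)"

lemma L_chain_restrict_op:
  assumes f: "L_chain n f" and g: "0 < g" "g \<le> n"
  shows "L_chain g (restrict_op g f)"
proof (rule L_chainI)
  have less: "f i k < g" if "k < g" for i k using L_chain_le[OF f, of i k] that by simp
  show "restrict_op g f i k < g" if "i < g" "k < g" for i k
    using that less by (simp add: restrict_op_def)
  show "restrict_op g f (restrict_op g f i j) (restrict_op g f i k) = restrict_op g f j k"
    if "i \<le> j" "j < g" "k < g" for i j k
    using that g less L_chain_cycloid[OF f] by (simp add: restrict_op_def)
qed (use g L_chain_eq_0_iff[OF f] L_chain_0[OF f] in \<open>auto simp: restrict_op_def\<close>)

lemma finite_L_chains: "finite {f. L_chain n f}"
proof -
  let ?S = "{..<n} \<times> {..<n}"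
  let ?F = "{F. \<forall>p. (p \<in> ?S \<longrightarrow> F p \<in> {..<n}) \<and> (p \<notin> ?S \<longrightarrow> F p = (0 :: nat))}"
  have "finite ?F" by (rule finite_set_of_finite_funs) auto
  moreover have "case_prod ` {f. L_chain n f} \<subseteq> ?F"
    using L_chain_less L_chain_outside by (auto simp: not_less)
  ultimately have "finite ((case_prod :: (nat \<Rightarrow> nat \<Rightarrow> nat) \<Rightarrow> _) ` {f. L_chain n f})"
    by (rule rev_finite_subset)
  then show ?thesis by (rule finite_imageD) (auto simp: inj_on_def fun_eq_iff)
qed

section \<open>Extending a chain by a row\<close>

locale L_chain_extension =
  fixes m g :: nat and h :: "nat \<Rightarrow> nat \<Rightarrow> nat" and \<psi> :: "nat \<Rightarrow> nat"
  assumes g_le: "g \<le> m" and base: "L_chain g h"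
    and row: "\<psi> \<in> strict_mono_maps {g<..m} {1..<m}"
begin

lemma row_eq_0: "k \<le> g \<or> m < k \<Longrightarrow> \<psi> k = 0"
  using row by (auto simp: strict_mono_maps_def)

lemma row_in: "g < k \<Longrightarrow> k \<le> m \<Longrightarrow> \<psi> k \<in> {1..<m}"
  using row by (force simp: strict_mono_maps_def)

lemma row_strict_mono: "strict_mono_on {g..m} \<psi>"
proof (rule strict_mono_onI)
  fix k l assume kl: "k \<in> {g..m}" "l \<in> {g..m}" "k < l"
  show "\<psi> k < \<psi> l"
  proof (cases "k = g")
    case True
    then show ?thesis using row_in[of l] kl by (simp add: row_eq_0)
  next
    case False
    moreover have "strict_mono_on {g<..m} \<psi>" using row by (simp add: strict_mono_maps_def)
    ultimately show ?thesis using kl by (auto dest: strict_mono_onD[of "{g<..m}" \<psi> k l])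
  qed
qed

lemma row_bottom_less: "\<psi> m < m"
proof (cases "g < m")
  case True
  then show ?thesis using row_in[of m] by simp
next
  case False
  then show ?thesis using g_le L_chain_pos[OF base] by (simp add: row_eq_0)
qed

lemma row_less:
  assumes "g \<le> k" "k \<le> m"
  shows "\<psi> k < k"
proof -
  have "\<psi> k + (m - k) \<le> \<psi> m"
    using assms by (intro strict_mono_on_diff_le monotone_on_subset[OF row_strict_mono]) auto
  then show ?thesis using row_bottom_less assms by linarith
qed

text \<open>
  The last line is forced by the equation \<open>f (f g j) (f g k) = f j k\<close>, since row \<open>g\<close> is to be \<open>\<psi>\<close>.
\<close>

function extend :: "nat \<Rightarrow> nat \<Rightarrow> nat" where
  "extend j k =
     (if m < j \<or> m < k then 0
      else if k < g then h j k
      else if j < g then k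
      else extend (\<psi> j) (\<psi> k))"
  by auto
termination by (relation "measure fst") (auto intro: row_less)

declare extend.simps [simp del]

lemma extend_outside: "m < j \<or> m < k \<Longrightarrow> extend j k = 0"
  by (subst extend.simps) simp

lemma extend_base: "k < g \<Longrightarrow> extend j k = h j k"
  using g_le L_chain_outside[OF base, of j k] by (subst extend.simps) auto

lemma extend_fixed: "j < g \<Longrightarrow> g \<le> k \<Longrightarrow> k \<le> m \<Longrightarrow> extend j k = k"
  using g_le by (subst extend.simps) simp

lemma extend_rec: "g \<le> j \<Longrightarrow> j \<le> m \<Longrightarrow> g \<le> k \<Longrightarrow> k \<le> m \<Longrightarrow> extend j k = extend (\<psi> j) (\<psi> k)"
  by (subst extend.simps) simp

lemma extend_0: "k \<le> m \<Longrightarrow> extend 0 k = k"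
  using L_chain_0[OF base] L_chain_pos[OF base] extend_base[of k 0] extend_fixed[of 0 k]
  by (cases "k < g") auto

lemma extend_le: "extend j k \<le> m"
proof (induction j k rule: extend.induct)
  case (1 j k)
  then show ?case
    using g_le L_chain_less[OF base, of j k] by (subst extend.simps) auto
qed

lemma extend_crossing_le: "k < g \<Longrightarrow> g \<le> j \<Longrightarrow> j \<le> m \<Longrightarrow> extend i k \<le> extend i j"
  using L_chain_less[OF base, of i k] L_chain_outside[OF base, of i k]
  by (cases "i < g") (simp_all add: extend_base extend_fixed)

lemma extend_eq_0_iff: "j \<le> m \<Longrightarrow> k \<le> m \<Longrightarrow> extend j k = 0 \<longleftrightarrow> k \<le> j"
proof (induction j k rule: extend.induct)
  case (1 j k)
  consider "k < g" "j < g" | "k < g" "g \<le> j" | "g \<le> k" "j < g" | (high) "g \<le> k" "g \<le> j"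
    by linarith
  then show ?case
  proof cases
    case high
    then have "extend (\<psi> j) (\<psi> k) = 0 \<longleftrightarrow> \<psi> k \<le> \<psi> j"
      using 1 row_less[of j] row_less[of k] by simp
    also have "\<dots> \<longleftrightarrow> k \<le> j"
      using high 1 by (simp add: strict_mono_on_less_eq[OF row_strict_mono])
    finally show ?thesis using high 1 by (simp add: extend_rec)
  qed (use 1 L_chain_outside[OF base] L_chain_eq_0_iff[OF base]
       in \<open>auto simp: extend_base extend_fixed\<close>)
qed

lemma extend_cycloid:
  "i \<le> j \<Longrightarrow> j \<le> m \<Longrightarrow> k \<le> m \<Longrightarrow> extend (extend i j) (extend i k) = extend j k"
proof (induction i arbitrary: j k rule: less_induct)
  case (less i)
  consider (low) "j < g" "k < g" | (straddling) "j < g" "g \<le> k" | (crossing) "g \<le> j" "k < g"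
    | (fixed) "i < g" "g \<le> j" "g \<le> k" | (high) "g \<le> i" "g \<le> k"
    by linarith
  then show ?case
  proof cases
    case low
    then show ?thesis
      using less.prems L_chain_cycloid[OF base] L_chain_less[OF base]
      by (simp add: extend_base)
  next
    case straddling
    then show ?thesis
      using less.prems L_chain_less[OF base] by (simp add: extend_base extend_fixed)
  next
    case crossing
    then have "extend i k \<le> extend i j" using less.prems by (simp add: extend_crossing_le)
    then have "extend (extend i j) (extend i k) = 0" by (simp add: extend_eq_0_iff extend_le)
    moreover have "extend j k = 0" using crossing less.prems by (simp add: extend_eq_0_iff)
    ultimately show ?thesis by simp
  next
    case fixed
    then show ?thesis using less.prems by (simp add: extend_fixed)
  next
    case high
    then have "\<psi> i < i" "\<psi> i \<le> \<psi> j" "\<psi> j \<le> m" "\<psi> k \<le> m"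
      using less.prems row_less[of i] row_less[of j] row_less[of k]
      by (simp_all add: strict_mono_on_less_eq[OF row_strict_mono])
    then show ?thesis using high less by (simp add: extend_rec)
  qed
qed

lemma L_chain_extend: "L_chain (Suc m) extend"
  by (rule L_chainI)
    (use extend_le extend_eq_0_iff extend_0 extend_cycloid extend_outside
      in \<open>auto simp: less_Suc_eq_le Suc_le_eq\<close>)

lemma extend_row: "extend g = \<psi>"
proof
  fix k
  consider "k < g" | (inner) "g \<le> k" "k \<le> m" | "m < k" by linarith
  then show "extend g k = \<psi> k"
  proof cases
    case inner
    then show ?thesis
      using g_le row_less[of k] by (simp add: extend_rec row_eq_0 extend_0)
  qed (use L_chain_outside[OF base] in \<open>simp_all add: extend_base extend_outside row_eq_0\<close>)
qed

lemma restrict_op_extend: "restrict_op g extend = h"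
  using L_chain_outside[OF base] by (intro ext) (auto simp: restrict_op_def extend_base not_less)

end

definition pivot :: "nat \<Rightarrow> (nat \<Rightarrow> nat \<Rightarrow> nat) \<Rightarrow> nat" where
  "pivot m f = (LEAST i. f i m < m)"

lemma (in L_chain_extension) pivot_extend: "pivot m extend = g"
  unfolding pivot_def
proof (rule Least_equality)
  show "extend g m < m" by (simp add: extend_row row_bottom_less)
  show "g \<le> i" if "extend i m < m" for i
    using that g_le extend_fixed[of i m] by (cases "g \<le> i") auto
qed

context
  fixes m :: nat and f :: "nat \<Rightarrow> nat \<Rightarrow> nat"
  assumes f: "L_chain (Suc m) f" and m: "0 < m"
begin

lemma bottom_row_moves_bottom: "f m m < m"
  using m L_chain_eq_0_iff[OF f, of m m] by simp

lemma pivot_moves_bottom: "f (pivot m f) m < m"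
  unfolding pivot_def by (rule LeastI[of _ m]) (rule bottom_row_moves_bottom)

lemma pivot_le: "pivot m f \<le> m"
  unfolding pivot_def by (rule Least_le) (rule bottom_row_moves_bottom)

lemma pivot_pos: "0 < pivot m f"
  using pivot_moves_bottom L_chain_0[OF f, of m] by (cases "pivot m f = 0") auto

lemma below_pivot_fixes_bottom:
  assumes "i < pivot m f"
  shows "f i m = m"
  using not_less_Least[OF assms[unfolded pivot_def]] L_chain_le[OF f, of i m] by simp

lemma below_pivot_fixes_pivot:
  assumes "i < pivot m f"
  shows "f i (pivot m f) = pivot m f"
proof (rule antisym)
  have "f (f i (pivot m f)) (f i m) = f (pivot m f) m"
    using assms pivot_le by (intro L_chain_cycloid[OF f]) auto
  then have "f (f i (pivot m f)) m < m"
    using below_pivot_fixes_bottom[OF assms] pivot_moves_bottom by simp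
  then show "pivot m f \<le> f i (pivot m f)"
    unfolding pivot_def by (rule Least_le)
qed (rule L_chain_le[OF f])

lemma below_pivot_fixes:
  assumes "i < pivot m f" "pivot m f \<le> k" "k \<le> m"
  shows "f i k = k"
proof (rule antisym)
  have "f i (pivot m f) + (k - pivot m f) \<le> f i k"
    using assms
    by (intro strict_mono_on_diff_le monotone_on_subset[OF L_chain_strict_mono_on[OF f, of i]]) auto
  then show "k \<le> f i k" using below_pivot_fixes_pivot[OF assms(1)] assms(2) by simp
qed (rule L_chain_le[OF f])

lemma pivot_row: "f (pivot m f) \<in> strict_mono_maps {pivot m f<..m} {1..<m}"
proof -
  let ?g = "pivot m f"
  have mono: "strict_mono_on {?g..<Suc m} (f ?g)"
    using pivot_le by (intro L_chain_strict_mono_on[OF f]) simp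
  have "f ?g k \<in> {1..<m}" if "?g < k" "k \<le> m" for k
    using that pivot_moves_bottom strict_mono_on_leD[OF mono, of k m] L_chain_eq_0_iff[OF f, of ?g k]
    by auto
  then have "f ?g ` {?g<..m} \<subseteq> {1..<m}" by force
  moreover have "f ?g k = 0" if "k \<notin> {?g<..m}" for k
    using that pivot_le L_chain_eq_0_iff[OF f, of ?g k] L_chain_outside[OF f, of ?g k]
    by (cases "k \<le> m") auto
  moreover have "strict_mono_on {?g<..m} (f ?g)"
    by (rule monotone_on_subset[OF mono]) auto
  ultimately show ?thesis by (simp add: strict_mono_maps_def)
qed

lemma L_chain_extension_pivot:
  "L_chain_extension m (pivot m f) (restrict_op (pivot m f) f) (f (pivot m f))"
proof
  show "L_chain (pivot m f) (restrict_op (pivot m f) f)"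
    using pivot_pos pivot_le by (intro L_chain_restrict_op[OF f]) auto
qed (rule pivot_le pivot_row)+

lemma extend_pivot:
  "L_chain_extension.extend m (pivot m f) (restrict_op (pivot m f) f) (f (pivot m f)) = f"
proof -
  let ?g = "pivot m f"
  interpret L_chain_extension m ?g "restrict_op ?g f" "f ?g"
    by (rule L_chain_extension_pivot)
  have "extend j k = f j k" for j k
  proof (induction j k rule: extend.induct)
    case (1 j k)
    consider (outside) "m < j \<or> m < k" | (low) "k < ?g" "j \<le> m"
      | (fixed) "j < ?g" "?g \<le> k" "k \<le> m" | (high) "?g \<le> j" "j \<le> m" "?g \<le> k" "k \<le> m"
      by linarith
    then show ?case
    proof cases
      case outside
      then show ?thesis using L_chain_outside[OF f, of j k] by (auto simp: extend_outside)
    next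
      case low
      then have "extend j k = restrict_op ?g f j k" by (intro extend_base)
      also have "\<dots> = f j k"
        using low pivot_le L_chain_eq_0_iff[OF f, of j k] by (auto simp: restrict_op_def)
      finally show ?thesis .
    next
      case fixed
      then show ?thesis by (simp add: extend_fixed below_pivot_fixes)
    next
      case high
      then have "extend j k = f (f ?g j) (f ?g k)" using 1 by (simp add: extend_rec)
      then show ?thesis using high L_chain_cycloid[OF f, of ?g j k] by simp
    qed
  qed
  then show ?thesis by blast
qed

end

lemma bij_betw_extend:
  assumes "0 < m"
  shows "bij_betw (\<lambda>(g, h, \<psi>). L_chain_extension.extend m g h \<psi>)
    (SIGMA g:{1..m}. {h. L_chain g h} \<times> strict_mono_maps {g<..m} {1..<m}) {f. L_chain (Suc m) f}"
proof (rule bij_betw_byWitness[where f' = "\<lambda>f. (pivot m f, restrict_op (pivot m f) f, f (pivot m f))"])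
  let ?D = "SIGMA g:{1..m}. {h. L_chain g h} \<times> strict_mono_maps {g<..m} {1..<m}"
  let ?extend = "\<lambda>(g, h, \<psi>). L_chain_extension.extend m g h \<psi>"
  let ?split = "\<lambda>f. (pivot m f, restrict_op (pivot m f) f, f (pivot m f))"
  have extension: "L_chain_extension m g h \<psi>" if "(g, h, \<psi>) \<in> ?D" for g h \<psi>
    using that by (simp add: L_chain_extension_def)
  show "\<forall>d\<in>?D. ?split (?extend d) = d"
    using L_chain_extension.pivot_extend[OF extension] L_chain_extension.restrict_op_extend[OF extension]
      L_chain_extension.extend_row[OF extension] by auto
  show "?extend ` ?D \<subseteq> {f. L_chain (Suc m) f}"
    using L_chain_extension.L_chain_extend[OF extension] by auto
  show "\<forall>f\<in>{f. L_chain (Suc m) f}. ?extend (?split f) = f"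
    using extend_pivot[OF _ assms] by simp
  show "?split ` {f. L_chain (Suc m) f} \<subseteq> ?D"
    using L_chain_extension_pivot[OF _ assms] pivot_pos[OF _ assms]
    by (auto simp: L_chain_extension_def Suc_le_eq)
qed

lemma card_L_chains_Suc:
  "card {f. L_chain (Suc (Suc n)) f} = (\<Sum>k\<le>n. (n choose k) * card {f. L_chain (Suc k) f})"
proof -
  let ?maps = "\<lambda>g. strict_mono_maps {g<..Suc n} {1..<Suc n} :: (nat \<Rightarrow> nat) set"
  have "card {f. L_chain (Suc (Suc n)) f} = card (SIGMA g:{1..Suc n}. {h. L_chain g h} \<times> ?maps g)"
    using bij_betw_same_card[OF bij_betw_extend[of "Suc n"]] by simp
  also have "\<dots> = (\<Sum>g\<in>{1..Suc n}. card ({h. L_chain g h} \<times> ?maps g))"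
    by (rule card_SigmaI) (simp_all add: finite_L_chains finite_strict_mono_maps)
  also have "\<dots> = (\<Sum>g\<in>{1..Suc n}. (n choose (Suc n - g)) * card {h. L_chain g h})"
    by (simp add: card_cartesian_product card_strict_mono_maps mult.commute)
  also have "\<dots> = (\<Sum>k\<le>n. (n choose (n - k)) * card {h. L_chain (Suc k) h})"
    by (simp add: sum.shift_bounds_cl_Suc_ivl atMost_atLeast0 del: sum.cl_ivl_Suc)
  also have "\<dots> = (\<Sum>k\<le>n. (n choose k) * card {h. L_chain (Suc k) h})"
    by (rule sum.cong) (simp_all flip: binomial_symmetric)
  finally show ?thesis .
qed

lemma L_chain_1_iff: "L_chain 1 f \<longleftrightarrow> f = (\<lambda>i k. 0)"
proof
  assume f: "L_chain 1 f"
  then show "f = (\<lambda>i k. 0)" using L_chain_less[OF f] by (intro ext) simp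
qed (auto intro: L_chainI)

lemma card_L_chains_eq_Bell: "card {f. L_chain (Suc n) f} = Bell n"
proof (induction n rule: less_induct)
  case (less n)
  show ?case
  proof (cases n)
    case 0
    then show ?thesis using L_chain_1_iff by (simp add: Bell_0)
  next
    case (Suc p)
    have "card {f. L_chain (Suc n) f} = (\<Sum>k\<le>p. (p choose k) * card {f. L_chain (Suc k) f})"
      unfolding Suc by (rule card_L_chains_Suc)
    also have "\<dots> = (\<Sum>k\<le>p. (p choose k) * Bell k)"
      using Suc by (intro sum.cong) (simp_all add: less.IH)
    also have "\<dots> = Bell n" by (simp add: Suc Bell_Suc)
    finally show ?thesis .
  qed
qed

section \<open>Isomorphism classes\<close>

lemma card_quotient_transversal:
  assumes r: "equiv A r" and "T \<subseteq> A"
    and meets: "\<And>x. x \<in> A \<Longrightarrow> \<exists>t\<in>T. (x, t) \<in> r"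
    and unique: "\<And>s t. s \<in> T \<Longrightarrow> t \<in> T \<Longrightarrow> (s, t) \<in> r \<Longrightarrow> s = t"
  shows "card (A // r) = card T"
proof -
  have "inj_on (\<lambda>t. r `` {t}) T"
    using \<open>T \<subseteq> A\<close> unique by (intro inj_onI) (meson eq_equiv_class r subsetD)
  moreover have "(\<lambda>t. r `` {t}) ` T = A // r"
  proof (intro equalityI subsetI)
    fix C assume "C \<in> A // r"
    then obtain x where x: "x \<in> A" "C = r `` {x}" by (rule quotientE)
    obtain t where "t \<in> T" "(x, t) \<in> r" using meets[OF x(1)] by blast
    then show "C \<in> (\<lambda>t. r `` {t}) ` T" using x(2) equiv_class_eq[OF r] by blast
  qed (use \<open>T \<subseteq> A\<close> in \<open>auto intro: quotientI\<close>)
  ultimately show ?thesis using card_image by fastforce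
qed

lemma L_chain_in_linear_L_algebras:
  assumes "L_chain n f"
  shows "({..<n}, f) \<in> linear_L_algebras n"
  using L_chain_L_algebra[OF assms] L_chain_L_le_iff[OF assms]
  by (auto simp: linear_L_algebras_def linear_L_algebra_def)

lemma L_chain_isomorphic_eq:
  assumes f: "L_chain n f" and f': "L_chain n f'"
    and iso: "L_isomorphic ({..<n}, f) ({..<n}, f')"
  shows "f = f'"
proof -
  obtain h where h: "bij_betw h {..<n} {..<n}"
    and hom: "\<And>x y. x < n \<Longrightarrow> y < n \<Longrightarrow> h (f x y) = f' (h x) (h y)"
    using iso by (auto simp: L_isomorphic_def)
  have h_less: "h x < n" if "x < n" for x using bij_betwE[OF h] that by simp
  have "h 0 = 0"
    using L_unit_isomorphic[OF L_chain_L_algebra[OF f] h, of f'] hom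
    by (simp add: L_chain_unit[OF f] L_chain_unit[OF f'])
  then have h_0: "h x = 0 \<longleftrightarrow> x = 0" if "x < n" for x
    using that inj_on_eq_iff[OF bij_betw_imp_inj_on[OF h], of x 0] L_chain_pos[OF f] by simp
  have h_le: "h x \<le> h y \<longleftrightarrow> x \<le> y" if "x < n" "y < n" for x y
  proof -
    have "h x \<le> h y \<longleftrightarrow> h (f y x) = 0"
      using that hom h_less by (simp add: L_chain_eq_0_iff[OF f'])
    also have "\<dots> \<longleftrightarrow> x \<le> y"
      using that L_chain_less[OF f] by (simp add: h_0 L_chain_eq_0_iff[OF f])
    finally show ?thesis .
  qed
  have "strict_mono_on {..<n} h"
    using h_le by (intro strict_mono_onI) (metis lessThan_iff not_le)
  then have h_id: "h x = x" if "x < n" for x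
    using that h strict_mono_on_eq_if_image_eq[of "{..<n}" h id x]
    by (simp add: strict_mono_on_id bij_betw_def)
  show ?thesis
  proof (intro ext)
    show "f i k = f' i k" for i k
      using hom[of i k] h_id L_chain_less[OF f] L_chain_outside[OF f] L_chain_outside[OF f']
      by (cases "i < n \<and> k < n") auto
  qed
qed

lemma linear_L_algebra_rank:
  assumes "linear_L_algebra X f" "finite X"
  obtains t where "bij_betw t X {..<card X}"
    and "\<And>x y. x \<in> X \<Longrightarrow> y \<in> X \<Longrightarrow> L_le X f x y \<longleftrightarrow> t y \<le> t x"
proof -
  have order: "linear_order_on X ((relation_of (L_le X f) X)\<inverse>)"
    using linear_order_on_L_le[OF assms(1)] by simp
  show thesis
    by (rule finite_linear_order_rank[OF \<open>finite X\<close> order], rule that) (auto simp: relation_of_def)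
qed

lemma L_chain_of_rank:
  assumes L: "L_algebra X f" and t: "bij_betw t X {..<n}"
    and t_le: "\<And>x y. x \<in> X \<Longrightarrow> y \<in> X \<Longrightarrow> L_le X f x y \<longleftrightarrow> t y \<le> t x"
  obtains f' where "L_chain n f'" "L_isomorphic (X, f) ({..<n}, f')"
proof -
  define s where "s = inv_into X t"
  define f' where "f' = restrict_op n (\<lambda>i k. t (f (s i) (s k)))"
  have s: "s i \<in> X" "t (s i) = i" if "i < n" for i
    using that bij_betwE[OF bij_betw_inv_into[OF t]] bij_betw_inv_into_right[OF t]
    by (simp_all add: s_def)
  have hom: "t (f x y) = f' (t x) (t y)" if "x \<in> X" "y \<in> X" for x y
    using that bij_betwE[OF t] bij_betw_inv_into_left[OF t] by (simp add: f'_def restrict_op_def s_def)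
  have unit: "t (L_unit X f) = 0"
  proof -
    have "0 < n" using L_unit_in[OF L] bij_betwE[OF t] by fastforce
    then have "L_le X f (s 0) (L_unit X f)"
      using L_unit_right[OF L] s by (simp add: L_le_def)
    then show ?thesis using \<open>0 < n\<close> t_le[of "s 0"] L_unit_in[OF L] s by simp
  qed
  have "f' i k = 0 \<longleftrightarrow> k \<le> i" if "i < n" "k < n" for i k
  proof -
    have "f' i k = 0 \<longleftrightarrow> t (f (s i) (s k)) = t (L_unit X f)"
      using that by (simp add: f'_def restrict_op_def unit)
    also have "\<dots> \<longleftrightarrow> L_le X f (s i) (s k)"
      using that L_unit_in[OF L] L_algebra_closed[OF L] s
      by (simp add: L_le_def inj_on_eq_iff[OF bij_betw_imp_inj_on[OF t]])
    also have "\<dots> \<longleftrightarrow> k \<le> i" using that t_le s by simp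
    finally show ?thesis .
  qed
  moreover have "L_algebra {..<n} f'"
    using L t hom by (rule L_algebra_isomorphic[where h = t and g = f'])
  moreover have "f' i k = 0" if "n \<le> i \<or> n \<le> k" for i k
    using that by (auto simp: f'_def restrict_op_def)
  ultimately have "L_chain n f'" unfolding L_chain_def by blast
  moreover have "L_isomorphic (X, f) ({..<n}, f')"
    unfolding L_isomorphic_def using t hom by (auto intro!: exI[of _ t])
  ultimately show thesis by (rule that)
qed

lemma linear_L_algebra_isomorphic_L_chain:
  assumes "(X, f) \<in> linear_L_algebras n"
  obtains f' where "L_chain n f'" "L_isomorphic (X, f) ({..<n}, f')"
proof -
  have lin: "linear_L_algebra X f" and "finite X" and card: "card X = n"
    using assms by (auto simp: linear_L_algebras_def)
  then have L: "L_algebra X f" by (simp add: linear_L_algebra_def)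
  obtain t where t: "bij_betw t X {..<n}"
    and t_le: "\<And>x y. x \<in> X \<Longrightarrow> y \<in> X \<Longrightarrow> L_le X f x y \<longleftrightarrow> t y \<le> t x"
    by (rule linear_L_algebra_rank[OF lin \<open>finite X\<close>, unfolded card], rule that)
  show thesis by (rule L_chain_of_rank[OF L t t_le]) (simp_all add: that)
qed

lemma num_linear_L_algebras_eq_card_L_chains: "num_linear_L_algebras n = card {f. L_chain n f}"
proof -
  let ?T = "Pair {..<n} ` {f. L_chain n f}"
  have "num_linear_L_algebras n = card ?T"
    unfolding num_linear_L_algebras_def
  proof (rule card_quotient_transversal[OF equiv_L_iso_rel])
    show T_subset: "?T \<subseteq> linear_L_algebras n" using L_chain_in_linear_L_algebras by auto
    show "\<exists>t\<in>?T. (A, t) \<in> L_iso_rel n" if A: "A \<in> linear_L_algebras n" for A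
    proof -
      obtain X f where Xf: "A = (X, f)" by (cases A)
      obtain f' where "L_chain n f'" "L_isomorphic A ({..<n}, f')"
        using linear_L_algebra_isomorphic_L_chain A unfolding Xf by blast
      then show ?thesis using A T_subset by (auto simp: L_iso_rel_def)
    qed
    show "s = t" if "s \<in> ?T" "t \<in> ?T" "(s, t) \<in> L_iso_rel n" for s t
      using that L_chain_isomorphic_eq by (auto simp: L_iso_rel_def)
  qed
  then show ?thesis by (simp add: card_image inj_on_def)
qed

theorem theorem4p5:
  fixes n :: nat
  assumes "n \<ge> 1"
  shows "num_linear_L_algebras n = Bell (n - 1)"
proof -
  have "num_linear_L_algebras n = card {f. L_chain (Suc (n - 1)) f}"
    using assms by (simp add: num_linear_L_algebras_eq_card_L_chains)
  also have "\<dots> = Bell (n - 1)" by (rule card_L_chains_eq_Bell)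
  finally show ?thesis .
qed

end
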